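(* Let $D$ be a division ring with center $F$, where $F$ is uncountable. Let $K$ be a division subring of $D$ containing $F$, and let $N$ be a normal subgroup of the multiplicative group $D^*$. If $N$ is non-central (that is, $N\not\subseteq F$), then $N$ is left algebraic over $K$ if and only if $D$ is left algebraic over $K$; likewise, $N$ is right algebraic over $K$ if and only if $D$ is right algebraic over $K$.
   Context: $D^*=D\setminus\{0\}$ is the multiplicative group of the division ring $D$. For a division subring $K$ of $D$, an element $a\in D$ is left algebraic over $K$ if there exist $m\ge 0$ and $a_0,a_1,\dots,a_m\in K$, not all zero, such that $a_0+a_1a+\cdots+a_ma^m=0$ (coefficients on the left); it is right algebraic over $K$ if there exist $m\ge 0$ and $a_0,\dots,a_m\in K$, not all zero, such that $a_0+aa_1+\cdots+a^ma_m=0$ (coefficients on the right). A subset $S\subseteq D$ is left (resp. right) algebraic over $K$ if every element of $S$ is left (resp. right) algebraic over $K$. Division rings are not assumed commutative. *)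

theory Defs
  imports "HOL-Library.Countable_Set" "HOL-Algebra.Coset"
begin

text \<open>
  A division ring is a type of class \<^class>\<open>division_ring\<close>, whose multiplication is not assumed
  commutative. Its multiplicative group is packaged as a monoid record, so that the normal
  subgroups are those of \<^theory>\<open>HOL-Algebra.Coset\<close>.
\<close>

definition mult_group_of_division_ring :: "'a::division_ring monoid" where
  "mult_group_of_division_ring = \<lparr>carrier = UNIV - {0}, mult = (*), one = 1\<rparr>"

lemma group_mult_group_of_division_ring:
  "group (mult_group_of_division_ring :: 'a::division_ring monoid)"
proof (rule groupI)
  fix x :: 'a
  assume "x \<in> carrier mult_group_of_division_ring"
  then show "\<exists>y\<in>carrier mult_group_of_division_ring.
      y \<otimes>\<^bsub>mult_group_of_division_ring\<^esub> x = \<one>\<^bsub>mult_group_of_division_ring\<^esub>"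
    by (intro bexI[of _ "inverse x"]) (auto simp: mult_group_of_division_ring_def)
qed (auto simp: mult_group_of_division_ring_def mult.assoc)

definition ring_center :: "'a::ring_1 set" where
  "ring_center = {z. \<forall>x. z * x = x * z}"

text \<open>
  No side condition \<open>x \<noteq> 0\<close> is needed for inverses, as \<open>inverse 0 = 0\<close>.
\<close>

definition division_subring :: "'a::division_ring set \<Rightarrow> bool" where
  "division_subring K \<longleftrightarrow>
     1 \<in> K \<and> (\<forall>x\<in>K. \<forall>y\<in>K. x - y \<in> K \<and> x * y \<in> K) \<and> (\<forall>x\<in>K. inverse x \<in> K)"

definition left_algebraic :: "'a::division_ring set \<Rightarrow> 'a \<Rightarrow> bool" where
  "left_algebraic K a \<longleftrightarrow>
     (\<exists>(m::nat) c. (\<forall>i\<le>m. c i \<in> K) \<and> (\<exists>i\<le>m. c i \<noteq> 0) \<and> (\<Sum>i\<le>m. c i * a ^ i) = 0)"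

definition right_algebraic :: "'a::division_ring set \<Rightarrow> 'a \<Rightarrow> bool" where
  "right_algebraic K a \<longleftrightarrow>
     (\<exists>(m::nat) c. (\<forall>i\<le>m. c i \<in> K) \<and> (\<exists>i\<le>m. c i \<noteq> 0) \<and> (\<Sum>i\<le>m. a ^ i * c i) = 0)"

definition left_algebraic_set :: "'a::division_ring set \<Rightarrow> 'a set \<Rightarrow> bool" where
  "left_algebraic_set K S \<longleftrightarrow> (\<forall>a\<in>S. left_algebraic K a)"

definition right_algebraic_set :: "'a::division_ring set \<Rightarrow> 'a set \<Rightarrow> bool" where
  "right_algebraic_set K S \<longleftrightarrow> (\<forall>a\<in>S. right_algebraic K a)"

end

theory Submission
  imports Defs
begin

text \<open>
  Let \<open>x\<close> be non-central. By the Cartan--Brauer--Hua argument some \<open>a \<in> N\<close> does not commute with \<open>x\<close>,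
  so that \<open>d = a\<inverse> x a - x\<close> is nonzero. For central \<open>z\<close> the element
  \<open>n = (x - z)\<inverse> a\<inverse> (x - z) a\<close> lies in \<open>N\<close> and satisfies \<open>(n - 1)\<inverse> = d\<inverse> (x - z)\<close>. Hence
  \<open>g z = d\<inverse> (x - z)\<close>, which is linear in \<open>z\<close>, is left algebraic for all central \<open>z\<close>. As the center
  is uncountable, the degree is bounded for infinitely many \<open>z\<close>, and a dimension count yields
  polynomials \<open>C i\<close> over \<open>K\<close>, not all zero, such that \<open>\<Sum>i. C i z * g z ^ i = 0\<close> for all central \<open>z\<close>.
  After cancelling a power of \<open>g z\<close>, let \<open>C l\<close> be the first nonzero polynomial. All other terms have
  the right factor \<open>x - z\<close>, so evaluating the indeterminate \<open>z\<close> at \<open>x\<close> on the right gives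
  \<open>C l x = 0\<close>. The right-sided claim is the left-sided one for the opposite ring.
\<close>

section \<open>Commutation with the center and closure of division subrings\<close>

lemma ring_center_commute: "z \<in> ring_center \<Longrightarrow> z * x = x * z"
  by (auto simp: ring_center_def)

lemma ring_center_power_commute:
  assumes "z \<in> ring_center"
  shows "z ^ k * x = x * z ^ k"
  using power_commuting_commutes[of z x k] ring_center_commute[OF assms] by simp

lemma division_subringD:
  assumes "division_subring K"
  shows "1 \<in> K" "0 \<in> K" "x \<in> K \<Longrightarrow> y \<in> K \<Longrightarrow> x - y \<in> K" "x \<in> K \<Longrightarrow> - x \<in> K"
    "x \<in> K \<Longrightarrow> y \<in> K \<Longrightarrow> x + y \<in> K" "x \<in> K \<Longrightarrow> y \<in> K \<Longrightarrow> x * y \<in> K"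
    "x \<in> K \<Longrightarrow> inverse x \<in> K"
proof -
  have d: "a - b \<in> K" if "a \<in> K" "b \<in> K" for a b
    using assms that by (simp add: division_subring_def)
  show one: "1 \<in> K" using assms by (simp add: division_subring_def)
  show zero: "0 \<in> K" using d[OF one one] by simp
  have m: "- b \<in> K" if "b \<in> K" for b using d[OF zero that] by simp
  show "x \<in> K \<Longrightarrow> y \<in> K \<Longrightarrow> x - y \<in> K" by (rule d)
  show "x \<in> K \<Longrightarrow> - x \<in> K" by (rule m)
  show "x \<in> K \<Longrightarrow> y \<in> K \<Longrightarrow> x + y \<in> K" using d[OF _ m] by fastforce
  show "x \<in> K \<Longrightarrow> y \<in> K \<Longrightarrow> x * y \<in> K" "x \<in> K \<Longrightarrow> inverse x \<in> K"
    using assms by (simp_all add: division_subring_def)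
qed

lemma division_subring_sum:
  assumes "division_subring K" "\<And>i. i \<in> I \<Longrightarrow> f i \<in> K"
  shows "sum f I \<in> K"
  using assms(2) by (induction I rule: infinite_finite_induct)
    (auto intro: division_subringD[OF assms(1)])

lemma division_subring_power:
  assumes "division_subring K" "x \<in> K"
  shows "x ^ n \<in> K"
  by (induction n) (auto intro: division_subringD[OF assms(1)] assms)

section \<open>Centralizers of conjugation-invariant subsets\<close>

text \<open>The argument is that of Cartan, Brauer and Hua.\<close>

lemma centralizer_of_normal_subset:
  fixes N :: "'a::division_ring set"
  assumes conj: "\<And>x n. x \<noteq> 0 \<Longrightarrow> n \<in> N \<Longrightarrow> x * n * inverse x \<in> N"
    and noncentral: "\<not> N \<subseteq> ring_center"
    and a: "\<And>n. n \<in> N \<Longrightarrow> a * n = n * a"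
  shows "a \<in> ring_center"
proof -
  \<comment> \<open>The centralizer \<open>C\<close> of \<open>N\<close> is shown to be a division
    subring. It inherits invariance under conjugation from \<open>N\<close>.\<close>
  define C where "C = {a. \<forall>n\<in>N. a * n = n * a}"
  have C_diff: "x - y \<in> C" if "x \<in> C" "y \<in> C" for x y
    using that by (simp add: C_def algebra_simps)
  have C_add: "x + y \<in> C" if "x \<in> C" "y \<in> C" for x y
    using that by (simp add: C_def algebra_simps)
  have C_mult: "x * y \<in> C" if "x \<in> C" "y \<in> C" for x y
    using that by (simp add: C_def) (metis mult.assoc)
  have C_one: "1 \<in> C" "0 \<in> C"
    by (simp_all add: C_def)
  have C_inverse: "inverse x \<in> C" if "x \<in> C" for x
  proof (cases "x = 0")
    case False
    have "inverse x * n = n * inverse x" if "n \<in> N" for n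
    proof -
      have "inverse x * n = inverse x * (n * x) * inverse x"
        using False by (simp add: mult.assoc)
      also have "n * x = x * n" using \<open>x \<in> C\<close> that by (simp add: C_def)
      also have "inverse x * (x * n) * inverse x = n * inverse x"
        using False by (simp flip: mult.assoc)
      finally show ?thesis .
    qed
    then show ?thesis by (simp add: C_def)
  qed (simp add: C_one)
  have C_conj: "b * x * inverse b \<in> C" if "x \<in> C" "b \<noteq> 0" for x b
  proof -
    have "b * x * inverse b * n = n * (b * x * inverse b)" if "n \<in> N" for n
    proof -
      have "inverse b * n * b \<in> N"
        using conj[of "inverse b" n] \<open>b \<noteq> 0\<close> that by simp
      then have eq: "x * (inverse b * n * b) = (inverse b * n * b) * x"
        using \<open>x \<in> C\<close> by (simp add: C_def)
      have "b * x * inverse b * n = b * (x * (inverse b * n * b)) * inverse b"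
        using \<open>b \<noteq> 0\<close> by (simp add: mult.assoc)
      also have "\<dots> = b * inverse b * n * (b * x * inverse b)"
        unfolding eq by (simp add: mult.assoc)
      finally show ?thesis using \<open>b \<noteq> 0\<close> by simp
    qed
    then show ?thesis by (simp add: C_def)
  qed
  have outside: "x * b = b * x" if x: "x \<in> C" and b: "b \<notin> C" for x b
  proof -
    have "b \<noteq> 0" using b C_one by auto
    have "b + 1 \<noteq> 0"
    proof
      assume "b + 1 = 0"
      then have "b = 0 - 1" by (metis add_diff_cancel)
      then show False using b C_diff C_one by metis
    qed
    \<comment> \<open>Conjugating \<open>x\<close> by both \<open>b\<close> and \<open>b + 1\<close>
      and subtracting gives \<open>(q - p) * b = x - q\<close> with \<open>p\<close>,
      \<open>q\<close> and \<open>x\<close> in \<open>C\<close>. If \<open>q \<noteq> p\<close>,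
      this could be solved for \<open>b\<close> inside \<open>C\<close>; hence \<open>q = p\<close>,
      and then \<open>x = p\<close>.\<close>
    define p where "p = b * x * inverse b"
    define q where "q = (b + 1) * x * inverse (b + 1)"
    have pC: "p \<in> C" and qC: "q \<in> C"
      unfolding p_def q_def using C_conj x \<open>b \<noteq> 0\<close> \<open>b + 1 \<noteq> 0\<close> by blast+
    have pb: "p * b = b * x"
      using \<open>b \<noteq> 0\<close> by (simp add: p_def mult.assoc)
    have "q * (b + 1) = (b + 1) * x"
      using \<open>b + 1 \<noteq> 0\<close> by (simp add: q_def mult.assoc)
    then have eq: "(q - p) * b = x - q"
      using pb by (simp add: algebra_simps)
    have "q = p"
    proof (rule ccontr)
      assume "q \<noteq> p"
      then have "b = inverse (q - p) * ((q - p) * b)"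
        by (simp flip: mult.assoc)
      then have "b = inverse (q - p) * (x - q)"
        by (simp only: eq)
      then show False
        using b C_mult C_inverse C_diff pC qC x by metis
    qed
    then have "x = p" using eq by simp
    then show ?thesis using pb by simp
  qed
  obtain b where b: "b \<notin> C"
    using noncentral by (auto simp: C_def ring_center_def) metis
  have aC: "a \<in> C" using a by (simp add: C_def)
  \<comment> \<open>Elements outside \<open>C\<close> commute with \<open>a\<close> by
    \<open>outside\<close>. An \<open>x\<close> in \<open>C\<close> is the difference of
    \<open>b + x\<close> and \<open>b\<close>, both of which lie outside.\<close>
  have "a * x = x * a" for x
  proof (cases "x \<in> C")
    case True
    then have "b + x \<notin> C" using b C_diff[of "b + x" x] by auto
    then have "a * (b + x) = (b + x) * a" "a * b = b * a"
      using outside aC b by blast+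
    then show ?thesis by (simp add: algebra_simps)
  qed (use outside aC in blast)
  then show ?thesis by (simp add: ring_center_def)
qed

section \<open>Homogeneous linear systems over a division subring\<close>

text \<open>Gaussian elimination with the unknowns on the left: equation \<open>j\<close> is used to
  eliminate one unknown \<open>h\<close>, which leaves one equation and one unknown fewer. Only
  operations of \<open>K\<close> occur, so the solution stays in \<open>K\<close>.\<close>

lemma homogeneous_system_solution:
  fixes A :: "'i \<Rightarrow> 'j \<Rightarrow> 'a::division_ring"
  assumes K: "division_subring K"
    and "finite J" "finite I" "card J < card I"
    and "\<And>i j. i \<in> I \<Longrightarrow> j \<in> J \<Longrightarrow> A i j \<in> K"
  shows "\<exists>c. (\<forall>i. c i \<in> K) \<and> (\<exists>i\<in>I. c i \<noteq> 0) \<and> (\<forall>j\<in>J. (\<Sum>i\<in>I. c i * A i j) = 0)"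
  using assms(2-)
proof (induction J arbitrary: I A rule: finite_induct)
  case empty
  then have "I \<noteq> {}" by auto
  then show ?case
    using division_subringD(1)[OF K] by (intro exI[of _ "\<lambda>_. 1"]) auto
next
  case (insert j J)
  show ?case
  proof (cases "\<forall>i\<in>I. A i j = 0")
    case True
    have "\<exists>c. (\<forall>i. c i \<in> K) \<and> (\<exists>i\<in>I. c i \<noteq> 0) \<and> (\<forall>j\<in>J. (\<Sum>i\<in>I. c i * A i j) = 0)"
      using insert.prems insert.hyps by (intro insert.IH) auto
    then show ?thesis using True by auto
  next
    case False
    then obtain h where h: "h \<in> I" "A h j \<noteq> 0" by auto
    \<comment> \<open>The multiplier satisfies \<open>A i j = r i * A h j\<close>; subtracting
      \<open>r i\<close> times row \<open>h\<close> from row \<open>i\<close> therefore clears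
      column \<open>j\<close>.\<close>
    define r where "r i = A i j * inverse (A h j)" for i
    have rK: "r i \<in> K" if "i \<in> I" for i
      unfolding r_def using insert.prems(3) that h by (intro division_subringD(6,7)[OF K]) auto
    have "\<exists>c. (\<forall>i. c i \<in> K) \<and> (\<exists>i\<in>I-{h}. c i \<noteq> 0) \<and>
        (\<forall>l\<in>J. (\<Sum>i\<in>I-{h}. c i * (A i l - r i * A h l)) = 0)"
    proof (rule insert.IH)
      show "finite (I - {h})" using insert.prems by simp
      show "card J < card (I - {h})" using insert.prems insert.hyps h by simp
      show "A i l - r i * A h l \<in> K" if "i \<in> I - {h}" "l \<in> J" for i l
        using that h insert.prems(3) rK by (intro division_subringD(3,6)[OF K]) auto
    qed
    then obtain c where c: "\<And>i. c i \<in> K" "\<exists>i\<in>I-{h}. c i \<noteq> 0"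
      "\<And>l. l \<in> J \<Longrightarrow> (\<Sum>i\<in>I-{h}. c i * (A i l - r i * A h l)) = 0" by blast
    \<comment> \<open>Equation \<open>j\<close> forces this value of the eliminated unknown
      \<open>h\<close>.\<close>
    define s where "s = - (\<Sum>i\<in>I-{h}. c i * r i)"
    define c' where "c' = c(h := s)"
    have split: "(\<Sum>i\<in>I. c' i * A i l) = (\<Sum>i\<in>I-{h}. c i * (A i l - r i * A h l))" for l
    proof -
      have "(\<Sum>i\<in>I. c' i * A i l) = s * A h l + (\<Sum>i\<in>I-{h}. c i * A i l)"
        using insert.prems(1) h by (subst sum.remove[of _ h]) (auto simp: c'_def intro!: sum.cong)
      also have "\<dots> = (\<Sum>i\<in>I-{h}. c i * (A i l - r i * A h l))"
        by (simp add: s_def right_diff_distrib sum_subtractf sum_distrib_right mult.assoc)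
      finally show ?thesis .
    qed
    have "(\<Sum>i\<in>I. c' i * A i l) = 0" if "l \<in> insert j J" for l
    proof (cases "l = j")
      case True
      have "r i * A h j = A i j" for i
        unfolding r_def mult.assoc left_inverse[OF h(2)] by simp
      then show ?thesis unfolding split True by simp
    next
      case False
      then show ?thesis unfolding split using c(3) that by simp
    qed
    moreover have "s \<in> K"
      unfolding s_def using c(1) rK
      by (intro division_subringD(4)[OF K] division_subring_sum[OF K] division_subringD(6)[OF K]) auto
    then have "\<forall>i. c' i \<in> K" using c(1) by (simp add: c'_def)
    moreover have "\<exists>i\<in>I. c' i \<noteq> 0" using c(2) by (auto simp: c'_def)
    ultimately show ?thesis by (intro exI[of _ c'] conjI) auto
  qed
qed

section \<open>Left algebraic elements under translation and inversion\<close>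

text \<open>Cutting the relation off at its last nonzero coefficient makes \<open>c m\<close> a
  leading coefficient, which stays visible under substitution and under reversal of the
  coefficients.\<close>

lemma left_algebraicE:
  assumes "left_algebraic K a"
  obtains m c where "\<And>i. i \<le> m \<Longrightarrow> c i \<in> K" "c m \<noteq> 0" "(\<Sum>i\<le>m. c i * a ^ i) = 0"
proof -
  obtain n c where c: "\<And>i. i \<le> n \<Longrightarrow> c i \<in> K" "\<exists>i\<le>n. c i \<noteq> 0" "(\<Sum>i\<le>n. c i * a ^ i) = 0"
    using assms by (auto simp: left_algebraic_def)
  define m where "m = (GREATEST i. i \<le> n \<and> c i \<noteq> 0)"
  have m: "m \<le> n" "c m \<noteq> 0"
    using GreatestI_ex_nat[of "\<lambda>i. i \<le> n \<and> c i \<noteq> 0" n] c(2) by (auto simp: m_def)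
  have above: "c i = 0" if "i \<le> n" "m < i" for i
    using Greatest_le_nat[of "\<lambda>i. i \<le> n \<and> c i \<noteq> 0" i n] that by (auto simp: m_def)
  have "(\<Sum>i\<le>m. c i * a ^ i) = (\<Sum>i\<le>n. c i * a ^ i)"
    using m above by (intro sum.mono_neutral_left) auto
  then show thesis using that[of m c] c m by auto
qed

text \<open>As \<open>1\<close> commutes with \<open>y\<close>, re-expanding in powers of
  \<open>y\<close> keeps the coefficients on the left. The unchanged leading coefficient ensures
  that a nontrivial relation remains nontrivial.\<close>

lemma left_polynomial_shift:
  fixes y :: "'a::division_ring"
  assumes K: "division_subring K" and "\<And>i. i \<le> m \<Longrightarrow> c i \<in> K"
  shows "\<exists>d. (\<forall>i\<le>m. d i \<in> K) \<and> d m = c m \<and>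
    (\<Sum>i\<le>m. c i * (y + 1) ^ i) = (\<Sum>i\<le>m. d i * y ^ i)"
  using assms(2)
proof (induction m arbitrary: c)
  case 0
  then show ?case by (intro exI[of _ c]) auto
next
  case (Suc m)
  have "\<exists>d. (\<forall>i\<le>m. d i \<in> K) \<and> d m = c (Suc m) \<and>
    (\<Sum>i\<le>m. c (Suc i) * (y + 1) ^ i) = (\<Sum>i\<le>m. d i * y ^ i)"
    using Suc.prems by (intro Suc.IH) auto
  then obtain d where d: "\<And>i. i \<le> m \<Longrightarrow> d i \<in> K" "d m = c (Suc m)"
    "(\<Sum>i\<le>m. c (Suc i) * (y + 1) ^ i) = (\<Sum>i\<le>m. d i * y ^ i)" by auto
  \<comment> \<open>These are the coefficients of
    \<open>c 0 + (\<Sum>i\<le>m. d i * y ^ i) * (y + 1)\<close>: the first summand comes from the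
    factor \<open>1\<close>, the second from the factor \<open>y\<close>, with \<open>c 0\<close>
    filling the free slot.\<close>
  define e where "e i = (if i \<le> m then d i else 0) + (case i of 0 \<Rightarrow> c 0 | Suc j \<Rightarrow> d j)" for i
  have "(\<Sum>i\<le>Suc m. c i * (y + 1) ^ i) = c 0 + (\<Sum>i\<le>m. c (Suc i) * (y + 1) ^ i) * (y + 1)"
    by (simp only: sum.atMost_Suc_shift power_Suc2 sum_distrib_right mult.assoc) simp
  also have "\<dots> = (\<Sum>i\<le>m. d i * y ^ i) + (c 0 + (\<Sum>i\<le>m. d i * y ^ Suc i))"
    unfolding d(3) by (simp only: power_Suc2 sum_distrib_right mult.assoc distrib_left) simp
  also have "(\<Sum>i\<le>m. d i * y ^ i) = (\<Sum>i\<le>Suc m. (if i \<le> m then d i else 0) * y ^ i)"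
    by simp
  also have "c 0 + (\<Sum>i\<le>m. d i * y ^ Suc i) =
      (\<Sum>i\<le>Suc m. (case i of 0 \<Rightarrow> c 0 | Suc j \<Rightarrow> d j) * y ^ i)"
    by (simp only: sum.atMost_Suc_shift) simp
  finally have "(\<Sum>i\<le>Suc m. c i * (y + 1) ^ i) = (\<Sum>i\<le>Suc m. e i * y ^ i)"
    by (simp only: e_def distrib_right sum.distrib)
  moreover have "e i \<in> K" if "i \<le> Suc m" for i
    unfolding e_def using that d(1) Suc.prems division_subringD(2)[OF K]
    by (intro division_subringD(5)[OF K]) (auto split: nat.splits)
  moreover have "e (Suc m) = c (Suc m)" by (simp add: e_def d(2))
  ultimately show ?case by (intro exI[of _ e] conjI) auto
qed

lemma left_algebraic_diff_one:
  assumes K: "division_subring K" and "left_algebraic K a"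
  shows "left_algebraic K (a - 1)"
proof -
  obtain m c where c: "\<And>i. i \<le> m \<Longrightarrow> c i \<in> K" "c m \<noteq> 0" "(\<Sum>i\<le>m. c i * a ^ i) = 0"
    using left_algebraicE[OF assms(2)] by blast
  obtain d where "\<forall>i\<le>m. d i \<in> K" "d m = c m"
    "(\<Sum>i\<le>m. c i * (a - 1 + 1) ^ i) = (\<Sum>i\<le>m. d i * (a - 1) ^ i)"
    using left_polynomial_shift[OF K c(1), of m "\<lambda>i. i" "a - 1"] by blast
  then show ?thesis
    using c unfolding left_algebraic_def by (intro exI[of _ m] exI[of _ d]) auto
qed

text \<open>Multiplying the relation on the right by \<open>inverse a ^ m\<close> reverses the order
  of the coefficients. The leading coefficient \<open>c m\<close> becomes the nonzero constant
  one.\<close>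

lemma left_algebraic_inverse:
  fixes a :: "'a::division_ring"
  assumes "left_algebraic K a" "a \<noteq> 0"
  shows "left_algebraic K (inverse a)"
proof -
  obtain m c where c: "\<And>i. i \<le> m \<Longrightarrow> c i \<in> K" "c m \<noteq> 0" "(\<Sum>i\<le>m. c i * a ^ i) = 0"
    using left_algebraicE[OF assms(1)] by blast
  have "(\<Sum>i\<le>m. c (m - i) * inverse a ^ i) = (\<Sum>i\<le>m. c i * inverse a ^ (m - i))"
    by (rule sum.reindex_bij_witness[of _ "\<lambda>i. m - i" "\<lambda>i. m - i"]) auto
  also have "\<dots> = (\<Sum>i\<le>m. c i * a ^ i) * inverse a ^ m"
    unfolding sum_distrib_right
  proof (rule sum.cong)
    fix i assume "i \<in> {..m}"
    then have "inverse a ^ m = inverse a ^ i * inverse a ^ (m - i)"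
      by (simp flip: power_add)
    then show "c i * inverse a ^ (m - i) = c i * a ^ i * inverse a ^ m"
      using assms(2) by (simp add: mult.assoc power_inverse flip: mult.assoc[of "a ^ i"])
  qed simp
  finally show ?thesis
    unfolding left_algebraic_def using c
    by (intro exI[of _ m] exI[of _ "\<lambda>i. c (m - i)"]) (auto intro!: exI[of _ 0])
qed

section \<open>Polynomial functions of a central variable\<close>

text \<open>
  Since the argument \<open>z\<close> is central, these functions behave like polynomials in a central
  indeterminate, with coefficients in a noncommutative ring.
\<close>

definition central_polyfun :: "nat \<Rightarrow> ('a::division_ring \<Rightarrow> 'a) \<Rightarrow> bool" where
  "central_polyfun n f \<longleftrightarrow> (\<exists>p. \<forall>z\<in>ring_center. f z = (\<Sum>k\<le>n. p k * z ^ k))"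

lemma central_polyfun_mono:
  assumes "central_polyfun n f" "n \<le> m"
  shows "central_polyfun m f"
proof -
  obtain p where p: "\<And>z. z \<in> ring_center \<Longrightarrow> f z = (\<Sum>k\<le>n. p k * z ^ k)"
    using assms(1) by (auto simp: central_polyfun_def)
  have "f z = (\<Sum>k\<le>m. (if k \<le> n then p k else 0) * z ^ k)" if "z \<in> ring_center" for z
    unfolding p[OF that] using assms(2) by (intro sum.mono_neutral_cong_left) auto
  then show ?thesis
    unfolding central_polyfun_def by (intro exI[of _ "\<lambda>k. if k \<le> n then p k else 0"] ballI)
qed

lemma central_polyfun_cong:
  "(\<And>z. z \<in> ring_center \<Longrightarrow> f z = g z) \<Longrightarrow> central_polyfun n f \<longleftrightarrow> central_polyfun n g"
  by (simp add: central_polyfun_def)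

lemma central_polyfun_cmult:
  assumes "central_polyfun n f"
  shows "central_polyfun n (\<lambda>z. b * f z)"
proof -
  obtain p where "\<And>z. z \<in> ring_center \<Longrightarrow> f z = (\<Sum>k\<le>n. p k * z ^ k)"
    using assms by (auto simp: central_polyfun_def)
  then have "b * f z = (\<Sum>k\<le>n. (b * p k) * z ^ k)" if "z \<in> ring_center" for z
    using that by (simp add: sum_distrib_left mult.assoc)
  then show ?thesis unfolding central_polyfun_def by (intro exI[of _ "\<lambda>k. b * p k"] ballI)
qed

lemma central_polyfun_add:
  assumes "central_polyfun n f" "central_polyfun n g"
  shows "central_polyfun n (\<lambda>z. f z + g z)"
proof -
  obtain p q where "\<And>z. z \<in> ring_center \<Longrightarrow> f z = (\<Sum>k\<le>n. p k * z ^ k)"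
    "\<And>z. z \<in> ring_center \<Longrightarrow> g z = (\<Sum>k\<le>n. q k * z ^ k)"
    using assms by (auto simp: central_polyfun_def)
  then have "f z + g z = (\<Sum>k\<le>n. (p k + q k) * z ^ k)" if "z \<in> ring_center" for z
    using that by (simp add: sum.distrib distrib_right)
  then show ?thesis unfolding central_polyfun_def by (intro exI[of _ "\<lambda>k. p k + q k"] ballI)
qed

lemma central_polyfun_const: "central_polyfun n (\<lambda>_. b)"
  by (rule central_polyfun_mono[of 0]) (auto simp: central_polyfun_def intro: exI[of _ "\<lambda>_. b"])

lemma central_polyfun_sum:
  assumes "\<And>i. i \<in> I \<Longrightarrow> central_polyfun n (f i)"
  shows "central_polyfun n (\<lambda>z. \<Sum>i\<in>I. f i z)"
  using assms by (induction I rule: infinite_finite_induct)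
    (auto intro: central_polyfun_add central_polyfun_const)

text \<open>A central \<open>z ^ k\<close> moves past \<open>a\<close> and \<open>b\<close>, so the
  product has the coefficients of the formal product: one copy multiplied by \<open>a\<close>, and
  one multiplied by \<open>b\<close> and shifted by a degree.\<close>

lemma sum_mult_linear:
  fixes z :: "'a::division_ring"
  assumes "z \<in> ring_center"
  shows "(\<Sum>k\<le>n. p k * z ^ k) * (a + b * z) =
    (\<Sum>k\<le>Suc n. ((if k \<le> n then p k * a else 0) + (case k of 0 \<Rightarrow> 0 | Suc j \<Rightarrow> p j * b)) * z ^ k)"
proof -
  have "(\<Sum>k\<le>n. p k * z ^ k) * (a + b * z) = (\<Sum>k\<le>n. p k * a * z ^ k) + (\<Sum>k\<le>n. p k * b * z ^ Suc k)"
  proof -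
    have "p k * z ^ k * (a + b * z) = p k * a * z ^ k + p k * b * z ^ Suc k" for k
    proof -
      have "p k * z ^ k * (a + b * z) = p k * (z ^ k * a) + p k * (z ^ k * b) * z"
        by (simp add: distrib_left mult.assoc)
      then show ?thesis
        unfolding ring_center_power_commute[OF assms] by (simp add: mult.assoc power_Suc2 del: power_Suc)
    qed
    then show ?thesis by (simp only: sum_distrib_right sum.distrib)
  qed
  also have "(\<Sum>k\<le>n. p k * a * z ^ k) = (\<Sum>k\<le>Suc n. (if k \<le> n then p k * a else 0) * z ^ k)"
    by simp
  also have "(\<Sum>k\<le>n. p k * b * z ^ Suc k) =
      (\<Sum>k\<le>Suc n. (case k of 0 \<Rightarrow> 0 | Suc j \<Rightarrow> p j * b) * z ^ k)"
    by (simp only: sum.atMost_Suc_shift) simp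
  finally show ?thesis by (simp only: distrib_right sum.distrib)
qed

lemma central_polyfun_mult_linear:
  assumes "central_polyfun n f"
  shows "central_polyfun (Suc n) (\<lambda>z. f z * (a + b * z))"
proof -
  obtain p where p: "\<And>z. z \<in> ring_center \<Longrightarrow> f z = (\<Sum>k\<le>n. p k * z ^ k)"
    using assms by (auto simp: central_polyfun_def)
  show ?thesis
    unfolding central_polyfun_def
    by (intro exI[of _ "\<lambda>k. (if k \<le> n then p k * a else 0) + (case k of 0 \<Rightarrow> 0 | Suc j \<Rightarrow> p j * b)"] ballI)
      (simp only: p sum_mult_linear)
qed

text \<open>Each central factor \<open>z\<close> can be moved to the right, where it is the linear
  factor \<open>0 + 1 * z\<close>.\<close>

lemma central_polyfun_mult_power:
  assumes "central_polyfun n f"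
  shows "central_polyfun (n + k) (\<lambda>z. z ^ k * f z)"
proof (induction k)
  case (Suc k)
  have "central_polyfun (Suc (n + k)) (\<lambda>z. (z ^ k * f z) * (0 + 1 * z))"
    by (rule central_polyfun_mult_linear[OF Suc])
  moreover have "z ^ k * f z * (0 + 1 * z) = z ^ Suc k * f z" if "z \<in> ring_center" for z
    using ring_center_commute[OF that, of "z ^ k * f z"] by (simp add: mult.assoc)
  ultimately show ?case
    using central_polyfun_cong[of "\<lambda>z. z ^ k * f z * (0 + 1 * z)" "\<lambda>z. z ^ Suc k * f z"] by auto
qed (simp add: assms)

section \<open>Division by a linear factor and vanishing of polynomial functions\<close>

text \<open>This is the remainder theorem, with evaluation to the right of the coefficients, proved
  by Horner's scheme. The leading coefficient of the quotient is recorded for inductions on the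
  degree.\<close>

lemma central_polynomial_division:
  fixes p :: "nat \<Rightarrow> 'a::division_ring"
  shows "\<exists>q. q n = p (Suc n) \<and> (\<forall>z\<in>ring_center.
    (\<Sum>k\<le>Suc n. p k * z ^ k) - (\<Sum>k\<le>Suc n. p k * x ^ k) = (\<Sum>k\<le>n. q k * z ^ k) * (z - x))"
proof (induction n arbitrary: p)
  case 0
  show ?case by (intro exI[of _ "\<lambda>_. p 1"]) (simp add: right_diff_distrib)
next
  case (Suc n)
  define P where "P y = (\<Sum>k\<le>Suc n. p (Suc k) * y ^ k)" for y
  obtain q where q: "q n = p (Suc (Suc n))"
    "\<And>z. z \<in> ring_center \<Longrightarrow> P z - P x = (\<Sum>k\<le>n. q k * z ^ k) * (z - x)"
    using Suc.IH[of "\<lambda>k. p (Suc k)"] unfolding P_def by blast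
  \<comment> \<open>The quotient for the higher degree has constant coefficient \<open>P x\<close>,
    followed by the coefficients of \<open>q\<close>, because
    \<open>(P z - P x) * z + P x * (z - x)\<close> is the difference to be factored.\<close>
  define r where "r = case_nat (P x) q"
  have horner: "(\<Sum>k\<le>Suc (Suc n). p k * y ^ k) = p 0 + P y * y" for y
    by (simp only: P_def sum.atMost_Suc_shift[of _ "Suc n"] power_Suc2 sum_distrib_right mult.assoc) simp
  have "(\<Sum>k\<le>Suc (Suc n). p k * z ^ k) - (\<Sum>k\<le>Suc (Suc n). p k * x ^ k) =
      (\<Sum>k\<le>Suc n. r k * z ^ k) * (z - x)" if z: "z \<in> ring_center" for z
  proof -
    have zx: "(z - x) * z = z * (z - x)"
      using ring_center_commute[OF z, of x] by (simp add: algebra_simps)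
    have "(p 0 + P z * z) - (p 0 + P x * x) = (P z - P x) * z + P x * (z - x)"
      by (simp add: algebra_simps)
    also have "\<dots> = ((\<Sum>k\<le>n. q k * z ^ k) * z + P x) * (z - x)"
      unfolding q(2)[OF z] by (simp add: distrib_right mult.assoc zx)
    also have "(\<Sum>k\<le>n. q k * z ^ k) * z + P x = (\<Sum>k\<le>Suc n. r k * z ^ k)"
      by (simp only: sum.atMost_Suc_shift power_Suc2 sum_distrib_right mult.assoc) (simp add: r_def)
    finally show ?thesis unfolding horner .
  qed
  moreover have "r (Suc n) = p (Suc (Suc n))" by (simp add: r_def q(1))
  ultimately show ?case by (intro exI[of _ r] conjI) auto
qed

text \<open>Dividing by the linear factor of one root leaves a quotient that vanishes at the other
  roots, so its leading coefficient is zero by induction; the rest has lower degree. Centrality of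
  the roots matters: over the quaternions \<open>t ^ 2 + 1\<close> has infinitely many non-central
  roots.\<close>

lemma central_polynomial_identity:
  fixes p :: "nat \<Rightarrow> 'a::division_ring"
  assumes "Z \<subseteq> ring_center" "n < card Z" "\<And>z. z \<in> Z \<Longrightarrow> (\<Sum>k\<le>n. p k * z ^ k) = 0" "k \<le> n"
  shows "p k = 0"
  using assms
proof (induction n arbitrary: p Z k)
  case 0
  then obtain z where "z \<in> Z" by fastforce
  then show ?case using 0(3)[of z] 0(4) by simp
next
  case (Suc n)
  have "finite Z" using Suc.prems(2) card.infinite by fastforce
  obtain x where x: "x \<in> Z" using Suc.prems(2) by fastforce
  obtain q where q: "q n = p (Suc n)" "\<And>z. z \<in> ring_center \<Longrightarrow>
    (\<Sum>k\<le>Suc n. p k * z ^ k) - (\<Sum>k\<le>Suc n. p k * x ^ k) = (\<Sum>k\<le>n. q k * z ^ k) * (z - x)"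
    using central_polynomial_division[of n p x] by auto
  have "q n = 0"
  proof (rule Suc.IH)
    show "Z - {x} \<subseteq> ring_center" using Suc.prems by auto
    show "n < card (Z - {x})" using Suc.prems(2) x \<open>finite Z\<close> by simp
    show "(\<Sum>k\<le>n. q k * z ^ k) = 0" if "z \<in> Z - {x}" for z
      using q(2)[of z] Suc.prems(1,3) that x by fastforce
  qed simp
  then have top: "p (Suc n) = 0" using q by simp
  show ?case
  proof (cases "k = Suc n")
    case False
    then show ?thesis
      using top Suc.prems by (intro Suc.IH[of Z p k]) auto
  qed (simp add: top)
qed

text \<open>A nonzero polynomial multiple of \<open>x - z\<close> has positive degree in
  \<open>z\<close>. Comparing coefficients, which is possible on an infinite center, therefore
  forces the multiplier and \<open>e\<close> to vanish.\<close>

lemma central_polyfun_mult_linear_eq_const: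
  fixes x :: "'a::division_ring"
  assumes inf: "infinite (ring_center :: 'a set)"
    and "central_polyfun n r" "\<And>z. z \<in> ring_center \<Longrightarrow> r z * (x - z) = e"
  shows "e = 0"
proof -
  obtain p where "\<And>z. z \<in> ring_center \<Longrightarrow> r z = (\<Sum>k\<le>n. p k * z ^ k)"
    using assms(2) by (auto simp: central_polyfun_def)
  then have p: "(\<Sum>k\<le>n. p k * z ^ k) * (x - z) = e" if "z \<in> ring_center" for z
    using assms(3) that by simp
  \<comment> \<open>These are the coefficients of \<open>r z * (x - z) - e\<close>.\<close>
  define s where "s k = (if k \<le> n then p k * x else 0) + (case k of 0 \<Rightarrow> 0 | Suc j \<Rightarrow> p j * (-1))
     - (if k = 0 then e else 0)" for k
  have zero: "s k = 0" if "k \<le> Suc n" for k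
  proof -
    obtain Z :: "'a set" where Z: "finite Z" "card Z = Suc (Suc n)" "Z \<subseteq> ring_center"
      using infinite_arbitrarily_large[OF inf] by metis
    have "(\<Sum>k\<le>Suc n. s k * z ^ k) = 0" if "z \<in> Z" for z
    proof -
      have zc: "z \<in> ring_center" using that Z by auto
      have "(\<Sum>k\<le>Suc n. s k * z ^ k) =
          (\<Sum>k\<le>n. p k * z ^ k) * (x + (-1) * z) - (\<Sum>k\<le>Suc n. (if k = 0 then e else 0) * z ^ k)"
        unfolding sum_mult_linear[OF zc] s_def left_diff_distrib sum_subtractf ..
      also have "(\<Sum>k\<le>Suc n. (if k = 0 then e else 0) * z ^ k) = e"
        by (simp only: sum.atMost_Suc_shift) simp
      finally show ?thesis using p[OF zc] by simp
    qed
    then show ?thesis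
      using central_polynomial_identity[of Z "Suc n" s k] Z that by simp
  qed
  \<comment> \<open>The coefficients vanish from the top down: \<open>s (Suc n)\<close> gives
    \<open>p n = 0\<close>, and each lower \<open>s\<close> gives the next one. Once
    \<open>n - i\<close> has reached \<open>0\<close>, truncated subtraction makes the step
    trivial.\<close>
  have "p (n - i) = 0" for i
  proof (induction i)
    case 0
    then show ?case using zero[of "Suc n"] by (simp add: s_def)
  next
    case (Suc i)
    show ?case
    proof (cases "i < n")
      case True
      then have "n - i = Suc (n - Suc i)" by simp
      then show ?thesis using zero[of "n - i"] Suc by (simp add: s_def split: if_splits)
    qed (use Suc in simp)
  qed
  from this[of n] show ?thesis using zero[of 0] by (simp add: s_def)
qed

lemma central_polyfun_eq_0:
  fixes f :: "'a::division_ring \<Rightarrow> 'a"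
  assumes "central_polyfun n f" "Z \<subseteq> ring_center" "n < card Z" "\<And>z. z \<in> Z \<Longrightarrow> f z = 0"
    and "z \<in> ring_center"
  shows "f z = 0"
proof -
  obtain p where p: "\<And>z. z \<in> ring_center \<Longrightarrow> f z = (\<Sum>k\<le>n. p k * z ^ k)"
    using assms(1) by (auto simp: central_polyfun_def)
  have "p k = 0" if "k \<le> n" for k
  proof (rule central_polynomial_identity[OF assms(2,3) _ that])
    show "(\<Sum>k\<le>n. p k * z ^ k) = 0" if "z \<in> Z" for z
      using p[of z] assms(2,4) that by auto
  qed
  then show ?thesis using p[OF assms(5)] by simp
qed

section \<open>From pointwise dependences to a polynomial dependence\<close>

text \<open>
  At each of the \<open>m * m + m + 2\<close> points of a set \<open>Z\<close>, the given dependence turns the vanishing of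
  \<open>\<Sum>i\<le>m. C i z * g z ^ i\<close> into \<open>m\<close> linear equations for the \<open>(m + 1) * (m * m + 2)\<close> coefficients
  of the polynomials \<open>C i\<close>. There are fewer equations than unknowns, and \<open>Z\<close> has more elements
  than the degree of the resulting polynomial function.
\<close>

lemma polynomial_dependence_from_pointwise:
  fixes g :: "'a::division_ring \<Rightarrow> 'a"
  assumes K: "division_subring K" and center: "ring_center \<subseteq> K"
    and S: "infinite S" "S \<subseteq> ring_center"
    and g: "\<And>i. central_polyfun i (\<lambda>z. g z ^ i)"
    and dep: "\<And>z. z \<in> S \<Longrightarrow>
      \<exists>b. (\<forall>i\<le>m. b i \<in> K) \<and> (\<exists>i\<le>m. b i \<noteq> 0) \<and> (\<Sum>i\<le>m. b i * g z ^ i) = 0"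
  shows "\<exists>s c. (\<forall>i k. c i k \<in> K) \<and> (\<exists>i\<le>m. \<exists>k\<le>Suc s. c i k \<noteq> 0) \<and>
    (\<forall>z\<in>ring_center. (\<Sum>i\<le>m. (\<Sum>k\<le>Suc s. c i k * z ^ k) * g z ^ i) = 0)"
proof -
  have "\<exists>b. \<forall>z\<in>S. (\<forall>i\<le>m. b z i \<in> K) \<and> (\<exists>i\<le>m. b z i \<noteq> 0) \<and> (\<Sum>i\<le>m. b z i * g z ^ i) = 0"
    by (rule bchoice) (use dep in simp)
  then obtain b where b: "\<And>z i. z \<in> S \<Longrightarrow> i \<le> m \<Longrightarrow> b z i \<in> K"
    "\<And>z. z \<in> S \<Longrightarrow> \<exists>i\<le>m. b z i \<noteq> 0"
    "\<And>z. z \<in> S \<Longrightarrow> (\<Sum>i\<le>m. b z i * g z ^ i) = 0"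
    by auto
  obtain h where h: "\<And>z. z \<in> S \<Longrightarrow> h z \<le> m" "\<And>z. z \<in> S \<Longrightarrow> b z (h z) \<noteq> 0"
    using b(2) by metis
  \<comment> \<open>With \<open>s + m + 2\<close> points there are \<open>(s + m + 2) * m\<close>
    equations for \<open>(m + 1) * (s + 2)\<close> unknowns. The surplus of unknowns is
    \<open>s + 2 - m * m\<close>, which is positive for this \<open>s\<close>.\<close>
  define s where "s = m * m"
  obtain Z where Z: "finite Z" "card Z = s + m + 2" "Z \<subseteq> S"
    using infinite_arbitrarily_large[OF S(1)] by metis
  \<comment> \<open>The relation at \<open>z\<close> is normalised to have coefficient
    \<open>1\<close> at its chosen nonzero position \<open>h z\<close>.\<close>
  define u where "u z j = inverse (b z (h z)) * b z j" for z j
  define I where "I = {..m} \<times> {..Suc s}"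
  \<comment> \<open>Equation \<open>(z, j)\<close> says \<open>C j z = C (h z) z * u z j\<close>.
    Together these make the values \<open>C j z\<close> a common left multiple of the relation at
    \<open>z\<close>. The case \<open>j = h z\<close> is automatic, which leaves \<open>m\<close>
    equations per point.\<close>
  define J where "J = (SIGMA z:Z. {..m} - {h z})"
  define A where "A = (\<lambda>(i, k) (z, j).
    (if i = j then z ^ k else 0) - (if i = h z then z ^ k * u z j else 0))"
  have "\<exists>c. (\<forall>i. c i \<in> K) \<and> (\<exists>i\<in>I. c i \<noteq> 0) \<and> (\<forall>j\<in>J. (\<Sum>i\<in>I. c i * A i j) = 0)"
  proof (rule homogeneous_system_solution[OF K])
    show "finite J" "finite I" using Z by (simp_all add: I_def J_def)
    have "card ({..m} - {h z}) = m" if "z \<in> Z" for z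
      using h(1)[of z] Z that by (subst card_Diff_singleton) auto
    then have "card J = (s + m + 2) * m"
      using Z by (simp add: J_def)
    also have "\<dots> < card I"
      by (simp add: I_def s_def card_cartesian_product algebra_simps)
    finally show "card J < card I" .
    show "A i j \<in> K" if "i \<in> I" "j \<in> J" for i j
    proof -
      obtain i' k z j' where eq: "i = (i', k)" "j = (z, j')" by fastforce
      have z: "z \<in> S" "z \<in> K" "j' \<le> m" using that(2) Z S center by (auto simp: eq J_def)
      have "z ^ k \<in> K" by (rule division_subring_power[OF K z(2)])
      moreover have "u z j' \<in> K"
        unfolding u_def using z b(1) h by (intro division_subringD(6,7)[OF K]) auto
      ultimately show ?thesis
        unfolding eq A_def using division_subringD(2,3,4,6)[OF K] by auto
    qed
  qed
  then obtain c where c: "\<And>i. c i \<in> K" "\<exists>i\<in>I. c i \<noteq> 0"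
    "\<And>j. j \<in> J \<Longrightarrow> (\<Sum>i\<in>I. c i * A i j) = 0" by blast
  define C where "C i z = (\<Sum>k\<le>Suc s. c (i, k) * z ^ k)" for i z
  have proportional: "C j z = C (h z) z * u z j" if z: "z \<in> Z" and j: "j \<le> m" for z j
  proof (cases "j = h z")
    case True
    have "u z (h z) = 1" unfolding u_def using h(2)[of z] z Z by (intro left_inverse) auto
    then show ?thesis by (simp add: True)
  next
    case False
    then have "0 = (\<Sum>i\<in>I. c i * A i (z, j))"
      using c(3)[of "(z, j)"] z j by (simp add: J_def)
    also have "\<dots> = (\<Sum>i\<le>m. \<Sum>k\<le>Suc s. c (i, k) * A (i, k) (z, j))"
      unfolding I_def by (simp only: sum.cartesian_product split_def prod.collapse)
    also have "\<dots> = (\<Sum>i\<le>m. (if i = j then C i z else 0) - (if i = h z then C i z * u z j else 0))"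
    proof (rule sum.cong)
      fix i
      show "(\<Sum>k\<le>Suc s. c (i, k) * A (i, k) (z, j)) =
          (if i = j then C i z else 0) - (if i = h z then C i z * u z j else 0)"
        using False
        by (cases "i = j"; cases "i = h z")
          (simp_all add: A_def C_def sum_negf distrib_right sum_distrib_right mult.assoc
            del: sum.atMost_Suc)
    qed simp
    also have "\<dots> = C j z - C (h z) z * u z j"
      unfolding sum_subtractf using j h(1)[of z] z Z by auto
    finally show ?thesis by simp
  qed
  define f where "f z = (\<Sum>i\<le>m. C i z * g z ^ i)" for z
  have "f z = 0" if "z \<in> ring_center" for z
  proof (rule central_polyfun_eq_0[of "s + m + 1" f Z])
    have "f = (\<lambda>z. \<Sum>i\<le>m. \<Sum>k\<le>Suc s. c (i, k) * (z ^ k * g z ^ i))"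
      by (rule ext) (simp only: f_def C_def sum_distrib_right mult.assoc)
    moreover have "central_polyfun (s + m + 1) (\<lambda>z. z ^ k * g z ^ i)" if "i \<le> m" "k \<le> Suc s" for i k
      using that by (intro central_polyfun_mono[OF central_polyfun_mult_power[OF g]]) auto
    ultimately show "central_polyfun (s + m + 1) f"
      by (simp only:) (intro central_polyfun_sum central_polyfun_cmult, simp)
    show "Z \<subseteq> ring_center" "s + m + 1 < card Z" using Z S by auto
    show "f z = 0" if "z \<in> Z" for z
    proof -
      have "f z = (\<Sum>i\<le>m. C (h z) z * inverse (b z (h z)) * (b z i * g z ^ i))"
        unfolding f_def using proportional[OF that]
        by (intro sum.cong) (simp_all add: u_def mult.assoc)
      also have "\<dots> = C (h z) z * inverse (b z (h z)) * (\<Sum>i\<le>m. b z i * g z ^ i)"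
        by (simp only: sum_distrib_left)
      also have "\<dots> = 0" using b(3)[of z] that Z by auto
      finally show ?thesis .
    qed
  qed (use that in auto)
  then show ?thesis
    using c(1,2) unfolding f_def C_def I_def
    by (intro exI[of _ s] exI[of _ "\<lambda>i k. c (i, k)"]) (auto simp del: sum.atMost_Suc)
qed

section \<open>Left algebraicity from a non-central normal subset\<close>

text \<open>Normality of \<open>N\<close> is expressed through ring operations, so that the result
  applies directly to the image of \<open>N\<close> in the opposite ring.\<close>

lemma left_algebraic_if_normal_subset:
  fixes x :: "'a::division_ring"
  assumes K: "division_subring K" and center: "ring_center \<subseteq> K"
    and uncountable: "uncountable (ring_center :: 'a set)"
    and N_mult: "\<And>a b. a \<in> N \<Longrightarrow> b \<in> N \<Longrightarrow> a * b \<in> N"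
    and N_inverse: "\<And>a. a \<in> N \<Longrightarrow> inverse a \<in> N"
    and N_conj: "\<And>b a. b \<noteq> 0 \<Longrightarrow> a \<in> N \<Longrightarrow> b * a * inverse b \<in> N"
    and N_nonzero: "0 \<notin> N"
    and noncentral: "\<not> N \<subseteq> ring_center"
    and algebraic: "\<And>a. a \<in> N \<Longrightarrow> left_algebraic K a"
  shows "left_algebraic K x"
proof (cases "x \<in> ring_center")
  case True
  then have "x \<in> K" using center by auto
  then show ?thesis
    unfolding left_algebraic_def using division_subringD(1,4)[OF K]
    by (intro exI[of _ 1] exI[of _ "\<lambda>i. if i = 0 then - x else 1"]) auto
next
  case False
  obtain a where a: "a \<in> N" "x * a \<noteq> a * x"
    using centralizer_of_normal_subset[OF N_conj noncentral, of x] False by blast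
  have "a \<noteq> 0" using a N_nonzero by auto
  define y where "y = inverse a * x * a"
  define d where "d = y - x"
  have "d \<noteq> 0"
  proof
    assume "d = 0"
    then have "a * (inverse a * x * a) = a * x" by (simp add: d_def y_def)
    moreover have "a * (inverse a * x * a) = x * a"
      using \<open>a \<noteq> 0\<close> by (simp flip: mult.assoc)
    ultimately show False using a(2) by simp
  qed
  define g where "g z = inverse d * (x - z)" for z
  have nz: "x - z \<noteq> 0" if "z \<in> ring_center" for z using that False by auto
  have g_nz: "g z \<noteq> 0" if "z \<in> ring_center" for z using nz[OF that] \<open>d \<noteq> 0\<close> by (simp add: g_def)
  have g_algebraic: "left_algebraic K (g z)" if z: "z \<in> ring_center" for z
  proof -
    have az: "inverse a * z * a = z"
      unfolding ring_center_commute[OF z, symmetric] using \<open>a \<noteq> 0\<close> by (simp add: mult.assoc)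
    have yz: "y - z = inverse a * (x - z) * a"
      using az by (simp add: y_def algebra_simps)
    \<comment> \<open>The double inverse is just \<open>x - z\<close>; in this form the first three
      factors are the conjugate of \<open>inverse a\<close> by \<open>inverse (x - z)\<close>, to
      which \<open>N_conj\<close> applies.\<close>
    define n where "n = inverse (x - z) * inverse a * inverse (inverse (x - z)) * a"
    have "n \<in> N"
      unfolding n_def using nz[OF z] by (intro N_mult[OF N_conj[OF _ N_inverse[OF a(1)]] a(1)]) simp
    then have "left_algebraic K (n - 1)"
      by (rule left_algebraic_diff_one[OF K algebraic])
    \<comment> \<open>Conjugation by \<open>a\<close> fixes the central \<open>z\<close>, so
      \<open>y - z\<close> and \<open>x - z\<close> differ by \<open>d\<close>, independently of
      \<open>z\<close>. This is what makes \<open>inverse (n - 1)\<close> linear in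
      \<open>z\<close>.\<close>
    moreover have n1: "n - 1 = inverse (x - z) * d"
    proof -
      have "n = inverse (x - z) * (y - z)"
        unfolding n_def yz using nz[OF z] by (simp add: mult.assoc)
      moreover have "d = (y - z) - (x - z)" by (simp add: d_def)
      ultimately show ?thesis
        using left_inverse[OF nz[OF z]] by (simp only: right_diff_distrib[of _ "y - z"])
    qed
    moreover have "n - 1 \<noteq> 0" "inverse (n - 1) = g z"
      unfolding n1 g_def using nz[OF z] \<open>d \<noteq> 0\<close> by (simp_all add: nonzero_inverse_mult_distrib)
    ultimately show ?thesis using left_algebraic_inverse[of K "n - 1"] by simp
  qed
  have g_polyfun: "central_polyfun i (\<lambda>z. g z ^ i)" for i
  proof (induction i)
    case (Suc i)
    have "g z ^ Suc i = g z ^ i * (inverse d * x + (- inverse d) * z)" for z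
      by (simp add: g_def power_Suc2 right_diff_distrib del: power_Suc)
    then show ?case using central_polyfun_mult_linear[OF Suc] by (simp only:)
  qed (simp add: central_polyfun_const)
  define T where "T m = {z \<in> ring_center.
    \<exists>b. (\<forall>i\<le>m. b i \<in> K) \<and> (\<exists>i\<le>m. b i \<noteq> 0) \<and> (\<Sum>i\<le>m. b i * g z ^ i) = 0}" for m
  have "ring_center = (\<Union>m. T m)"
    using g_algebraic by (auto simp: T_def left_algebraic_def)
  then have "\<not> (\<forall>m. finite (T m))"
    using uncountable countable_UN[of UNIV T] by (auto intro: countable_finite)
  then obtain m where m: "infinite (T m)" by auto
  have "\<exists>s c. (\<forall>i k. c i k \<in> K) \<and> (\<exists>i\<le>m. \<exists>k\<le>Suc s. c i k \<noteq> 0) \<and>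
    (\<forall>z\<in>ring_center. (\<Sum>i\<le>m. (\<Sum>k\<le>Suc s. c i k * z ^ k) * g z ^ i) = 0)"
    by (rule polynomial_dependence_from_pointwise[OF K center m _ g_polyfun]) (auto simp only: T_def)
  then obtain s c where sc: "(\<forall>i k. c i k \<in> K) \<and> (\<exists>i\<le>m. \<exists>k\<le>Suc s. c i k \<noteq> 0) \<and>
    (\<forall>z\<in>ring_center. (\<Sum>i\<le>m. (\<Sum>k\<le>Suc s. c i k * z ^ k) * g z ^ i) = 0)"
    by (elim exE)
  have c: "\<And>i k. c i k \<in> K" "\<exists>i\<le>m. \<exists>k\<le>Suc s. c i k \<noteq> 0"
    "\<And>z. z \<in> ring_center \<Longrightarrow> (\<Sum>i\<le>m. (\<Sum>k\<le>Suc s. c i k * z ^ k) * g z ^ i) = 0"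
    using sc by blast+
  define C where "C i z = (\<Sum>k\<le>Suc s. c i k * z ^ k)" for i z
  define l where "l = (LEAST i. i \<le> m \<and> (\<exists>k\<le>Suc s. c i k \<noteq> 0))"
  have l: "l \<le> m" "\<exists>k\<le>Suc s. c l k \<noteq> 0"
    using LeastI_ex[OF c(2)] by (simp_all add: l_def)
  have below: "C i z = 0" if "i < l" for i z
  proof -
    have "c i k = 0" if "k \<le> Suc s" for k
      using not_less_Least[of i "\<lambda>i. i \<le> m \<and> (\<exists>k\<le>Suc s. c i k \<noteq> 0)"] \<open>i < l\<close> l(1) that
      by (auto simp: l_def)
    then show ?thesis by (simp add: C_def)
  qed
  \<comment> \<open>All terms above \<open>l\<close> have a right factor
    \<open>g z = inverse d * (x - z)\<close> left after the cancellation; \<open>r z\<close> is what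
    remains when \<open>x - z\<close> is split off.\<close>
  define r where "r z = (\<Sum>i\<in>{l<..m}. C i z * g z ^ (i - Suc l) * inverse d)" for z
  have r: "C l z + r z * (x - z) = 0" if z: "z \<in> ring_center" for z
  proof -
    have "0 = (\<Sum>i\<le>m. C i z * g z ^ i)" using c(3)[OF z] by (simp add: C_def)
    also have "\<dots> = (\<Sum>i\<in>{l..m}. C i z * g z ^ i)"
      using below by (intro sum.mono_neutral_right) auto
    also have "\<dots> = (\<Sum>i\<in>{l..m}. C i z * g z ^ (i - l) * g z ^ l)"
      by (intro sum.cong) (simp_all add: mult.assoc flip: power_add)
    also have "\<dots> = (\<Sum>i\<in>{l..m}. C i z * g z ^ (i - l)) * g z ^ l"
      by (simp only: sum_distrib_right)
    finally have "0 = (\<Sum>i\<in>{l..m}. C i z * g z ^ (i - l))"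
      using g_nz[OF z] by simp
    also have "{l..m} = insert l {l<..m}" using l(1) by auto
    also have "(\<Sum>i\<in>insert l {l<..m}. C i z * g z ^ (i - l)) =
        C l z + (\<Sum>i\<in>{l<..m}. C i z * g z ^ (i - l))" by simp
    also have "(\<Sum>i\<in>{l<..m}. C i z * g z ^ (i - l)) = r z * (x - z)"
      unfolding r_def sum_distrib_right
    proof (rule sum.cong)
      fix i assume "i \<in> {l<..m}"
      then have "i - l = Suc (i - Suc l)" by auto
      then show "C i z * g z ^ (i - l) = C i z * g z ^ (i - Suc l) * inverse d * (x - z)"
        by (simp only: power_Suc2) (simp add: g_def mult.assoc)
    qed simp
    finally show ?thesis by simp
  qed
  have r_polyfun: "central_polyfun (Suc (Suc s + m)) r"
  proof -
    have "central_polyfun (Suc s + m) (\<lambda>z. C i z * g z ^ (i - Suc l))" if "i \<le> m" for i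
    proof -
      have "(\<lambda>z. C i z * g z ^ j) = (\<lambda>z. \<Sum>k\<le>Suc s. c i k * (z ^ k * g z ^ j))" for j
        by (simp only: C_def sum_distrib_right mult.assoc)
      moreover have "central_polyfun (Suc s + m) (\<lambda>z. z ^ k * g z ^ (i - Suc l))" if "k \<le> Suc s" for k
        using that \<open>i \<le> m\<close>
        by (intro central_polyfun_mono[OF central_polyfun_mult_power[OF g_polyfun]]) auto
      ultimately show ?thesis
        by (simp only:) (intro central_polyfun_sum central_polyfun_cmult, simp)
    qed
    \<comment> \<open>The constant right factor \<open>inverse d\<close> is treated as a linear one
      with slope \<open>0\<close>, which raises the degree bound by one.\<close>
    then have "central_polyfun (Suc (Suc s + m)) (\<lambda>z. C i z * g z ^ (i - Suc l) * (inverse d + 0 * z))"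
      if "i \<le> m" for i
      using that by (intro central_polyfun_mult_linear)
    then show ?thesis unfolding r_def by (intro central_polyfun_sum) simp
  qed
  obtain q where q: "\<And>z. z \<in> ring_center \<Longrightarrow> C l z - C l x = (\<Sum>k\<le>s. q k * z ^ k) * (z - x)"
    using central_polynomial_division[of s "c l" x] by (auto simp only: C_def)
  have q_polyfun: "central_polyfun s (\<lambda>z. \<Sum>k\<le>s. q k * z ^ k)"
    unfolding central_polyfun_def by (intro exI[of _ q] ballI) simp
  \<comment> \<open>Combining \<open>r\<close> with the remainder formula expresses the constant
    \<open>C l x\<close> as a polynomial multiple of \<open>x - z\<close> for every central
    \<open>z\<close>. Its vanishing is the desired relation for \<open>x\<close>, with the
    coefficients \<open>c l\<close>.\<close>
  have "C l x = 0"
  proof (rule central_polyfun_mult_linear_eq_const)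
    show "infinite (ring_center :: 'a set)" using uncountable countable_finite by blast
    show "central_polyfun (Suc (Suc s + m)) (\<lambda>z. (- 1) * r z + (\<Sum>k\<le>s. q k * z ^ k))"
      by (intro central_polyfun_add central_polyfun_cmult r_polyfun central_polyfun_mono[OF q_polyfun])
        simp
    show "((- 1) * r z + (\<Sum>k\<le>s. q k * z ^ k)) * (x - z) = C l x" if "z \<in> ring_center" for z
    proof -
      have "(\<Sum>k\<le>s. q k * z ^ k) * (x - z) = - (C l z - C l x)"
        unfolding q[OF that] by (simp flip: mult_minus_right)
      moreover have "- 1 * r z * (x - z) = C l z"
        using r[OF that] by (simp add: eq_neg_iff_add_eq_0[symmetric])
      ultimately show ?thesis
        unfolding distrib_right by simp
    qed
  qed
  then show ?thesis
    unfolding left_algebraic_def C_def using c(1) l(2)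
    by (intro exI[of _ "Suc s"] exI[of _ "c l"]) auto
qed

section \<open>The opposite ring and the right-sided claim\<close>

text \<open>Division rings are types of a class, so the reversed multiplication needs a type of its
  own to carry the second instance.\<close>

datatype 'a opposite = Opposite (unopposite: 'a)

instantiation opposite :: (division_ring) division_ring
begin

definition "0 = Opposite 0"
definition "1 = Opposite 1"
definition "x + y = Opposite (unopposite x + unopposite y)"
definition "x - y = Opposite (unopposite x - unopposite y)"
definition "- x = Opposite (- unopposite x)"
definition "x * y = Opposite (unopposite y * unopposite x)"
definition "inverse x = Opposite (inverse (unopposite x))"
definition "x div y = x * inverse (y :: 'a opposite)"

lemmas opposite_defs = zero_opposite_def one_opposite_def plus_opposite_def minus_opposite_def
  uminus_opposite_def times_opposite_def inverse_opposite_def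

instance
proof
  show "inverse a * a = 1" "a * inverse a = 1" if "a \<noteq> 0" for a :: "'a opposite"
    using that by (cases a; simp add: opposite_defs)+
qed (simp_all add: opposite_defs divide_opposite_def algebra_simps)

end

lemma Opposite_power: "Opposite a ^ n = Opposite (a ^ n)"
  by (induction n) (simp_all add: opposite_defs power_commutes)

lemma Opposite_sum: "(\<Sum>i\<in>I. Opposite (f i)) = Opposite (sum f I)"
  by (induction I rule: infinite_finite_induct) (simp_all add: opposite_defs)

lemma ring_center_opposite: "ring_center = Opposite ` ring_center"
proof -
  have "Opposite z \<in> ring_center \<longleftrightarrow> z \<in> ring_center" for z :: 'a
    unfolding ring_center_def by (auto simp: opposite_defs) (metis opposite.sel)
  then have "w \<in> ring_center \<longleftrightarrow> w \<in> Opposite ` ring_center" for w :: "'a opposite"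
    by (cases w) auto
  then show ?thesis by blast
qed

lemma left_algebraic_opposite:
  "left_algebraic (Opposite ` K) (Opposite a) \<longleftrightarrow> right_algebraic K a"
proof
  assume "left_algebraic (Opposite ` K) (Opposite a)"
  then obtain m c where c: "\<forall>i\<le>m. c i \<in> Opposite ` K" "\<exists>i\<le>m. c i \<noteq> 0"
    "(\<Sum>i\<le>m. c i * Opposite a ^ i) = 0"
    by (auto simp: left_algebraic_def)
  have "c i * Opposite a ^ i = Opposite (a ^ i * unopposite (c i))" for i
    by (simp add: Opposite_power opposite_defs)
  then have "(\<Sum>i\<le>m. a ^ i * unopposite (c i)) = 0"
    using c(3) by (simp add: Opposite_sum) (simp add: opposite_defs)
  then show "right_algebraic K a"
    unfolding right_algebraic_def using c(1,2)
    by (intro exI[of _ m] exI[of _ "\<lambda>i. unopposite (c i)"])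
      (auto simp: opposite_defs opposite.expand)
next
  assume "right_algebraic K a"
  then obtain m c where c: "\<forall>i\<le>m. c i \<in> K" "\<exists>i\<le>m. c i \<noteq> 0" "(\<Sum>i\<le>m. a ^ i * c i) = 0"
    by (auto simp: right_algebraic_def)
  have "Opposite (c i) * Opposite a ^ i = Opposite (a ^ i * c i)" for i
    by (simp add: Opposite_power opposite_defs)
  then show "left_algebraic (Opposite ` K) (Opposite a)"
    unfolding left_algebraic_def using c
    by (intro exI[of _ m] exI[of _ "\<lambda>i. Opposite (c i)"])
      (auto simp: Opposite_sum, auto simp: opposite_defs)
qed

lemma right_algebraic_if_normal_subset:
  fixes x :: "'a::division_ring"
  assumes K: "division_subring K" and center: "ring_center \<subseteq> K"
    and uncountable: "uncountable (ring_center :: 'a set)"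
    and N_mult: "\<And>a b. a \<in> N \<Longrightarrow> b \<in> N \<Longrightarrow> a * b \<in> N"
    and N_inverse: "\<And>a. a \<in> N \<Longrightarrow> inverse a \<in> N"
    and N_conj: "\<And>b a. b \<noteq> 0 \<Longrightarrow> a \<in> N \<Longrightarrow> b * a * inverse b \<in> N"
    and N_nonzero: "0 \<notin> N"
    and noncentral: "\<not> N \<subseteq> ring_center"
    and algebraic: "\<And>a. a \<in> N \<Longrightarrow> right_algebraic K a"
  shows "right_algebraic K x"
  unfolding left_algebraic_opposite[symmetric]
proof (rule left_algebraic_if_normal_subset[where N = "Opposite ` N"])
  have inj: "inj Opposite" by (auto intro: injI)
  show "division_subring (Opposite ` K)"
    using K by (auto simp: division_subring_def opposite_defs)
  show "ring_center \<subseteq> Opposite ` K" using center by (subst ring_center_opposite) auto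
  show "uncountable (ring_center :: 'a opposite set)"
    using uncountable countable_image_inj_eq[of Opposite "ring_center :: 'a set"] inj
    by (subst ring_center_opposite) (simp add: inj_on_def)
  show "a * b \<in> Opposite ` N" if "a \<in> Opposite ` N" "b \<in> Opposite ` N" for a b
    using that N_mult by (auto simp: opposite_defs)
  show "inverse a \<in> Opposite ` N" if "a \<in> Opposite ` N" for a
    using that N_inverse by (auto simp: opposite_defs)
  show "b * a * inverse b \<in> Opposite ` N" if ba: "b \<noteq> 0" "a \<in> Opposite ` N" for a b
  proof -
    obtain b' where "b = Opposite b'" by (cases b)
    then obtain a' where eq: "b = Opposite b'" "a = Opposite a'" "a' \<in> N" "b' \<noteq> 0"
      using ba by (auto simp: opposite_defs)
    \<comment> \<open>Conjugation by \<open>b\<close> in the opposite ring is conjugation by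
      \<open>inverse b'\<close> in the original one.\<close>
    then have "inverse b' * a' * inverse (inverse b') \<in> N"
      by (intro N_conj) auto
    then show ?thesis using eq by (auto simp: opposite_defs mult.assoc)
  qed
  show "0 \<notin> Opposite ` N" using N_nonzero by (auto simp: opposite_defs)
  show "\<not> Opposite ` N \<subseteq> ring_center" using noncentral by (subst ring_center_opposite) auto
  show "left_algebraic (Opposite ` K) a" if "a \<in> Opposite ` N" for a
    using that algebraic by (auto simp: left_algebraic_opposite)
qed

section \<open>Normal subgroups of the multiplicative group\<close>

lemma inv_mult_group_of_division_ring:
  fixes a :: "'a::division_ring"
  assumes "a \<noteq> 0"
  shows "inv\<^bsub>mult_group_of_division_ring\<^esub> a = inverse a"
  by (rule group.inv_equality[OF group_mult_group_of_division_ring])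
    (use assms in \<open>auto simp: mult_group_of_division_ring_def\<close>)

theorem theorem3p3:
  fixes F K N :: "'a::division_ring set"
  assumes "F = ring_center"
    and "uncountable F"
    and "division_subring K"
    and "F \<subseteq> K"
    and "N \<lhd> (mult_group_of_division_ring :: 'a monoid)"
    and "\<not> N \<subseteq> F"
  shows "(left_algebraic_set K N \<longleftrightarrow> left_algebraic_set K (UNIV :: 'a set)) \<and>
         (right_algebraic_set K N \<longleftrightarrow> right_algebraic_set K (UNIV :: 'a set))"
proof -
  let ?G = "mult_group_of_division_ring :: 'a monoid"
  note subgroup = normal_imp_subgroup[OF assms(5)]
  have nonzero: "a \<noteq> 0" if "a \<in> N" for a
    using subgroup.subset[OF subgroup] that by (auto simp: mult_group_of_division_ring_def)
  have N_mult: "a * b \<in> N" if "a \<in> N" "b \<in> N" for a b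
    using subgroup.m_closed[OF subgroup that] by (simp add: mult_group_of_division_ring_def)
  have N_inverse: "inverse a \<in> N" if "a \<in> N" for a
    using subgroup.m_inv_closed[OF subgroup that] nonzero[OF that] by (simp add: inv_mult_group_of_division_ring)
  have N_conj: "b * a * inverse b \<in> N" if "b \<noteq> 0" "a \<in> N" for a b
  proof -
    have "b \<in> carrier ?G" using that by (simp add: mult_group_of_division_ring_def)
    from normal.inv_op_closed2[OF assms(5) this that(2)] show ?thesis
      using that(1) inv_mult_group_of_division_ring[OF that(1)]
      by (simp add: mult_group_of_division_ring_def)
  qed
  have N_nonzero: "0 \<notin> N" using nonzero by blast
  note hyps = assms(3) assms(4,2)[unfolded assms(1)] N_mult N_inverse N_conj N_nonzero
    assms(6)[unfolded assms(1)]
  have "left_algebraic K x" if "left_algebraic_set K N" for x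
    by (rule left_algebraic_if_normal_subset[OF hyps])
      (use that in \<open>auto simp: left_algebraic_set_def\<close>)
  moreover have "right_algebraic K x" if "right_algebraic_set K N" for x
    by (rule right_algebraic_if_normal_subset[OF hyps])
      (use that in \<open>auto simp: right_algebraic_set_def\<close>)
  ultimately show ?thesis by (auto simp: left_algebraic_set_def right_algebraic_set_def)
qed

end
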